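(* Let $d$ be a positive integer and $\chi$ a primitive Dirichlet character of conductor $d$. Let $w_1,w_2,w_3$ be any positive integers, $y_1,y_2\in\mathbb{Z}_p$, and $n\ge0$ an integer. Then \begin{align*} &w_{1}^{n-1}\sum_{k=0}^{n}\binom{n}{k}B_{k,\chi}(w_{3}y_{1})\sum_{a=0}^{w_{1}d-1}\chi(a)B_{n-k,\chi}\Big(w_{2}y_{2}+\frac{w_{2}}{w_{1}}a\Big)w_{3}^{n-k}w_{2}^{k}\\ =&w_{1}^{n-1}\sum_{k=0}^{n}\binom{n}{k}B_{k,\chi}(w_{2}y_{1})\sum_{a=0}^{w_{1}d-1}\chi(a)B_{n-k,\chi}\Big(w_{3}y_{2}+\frac{w_{3}}{w_{1}}a\Big)w_{2}^{n-k}w_{3}^{k}\\ =&w_{2}^{n-1}\sum_{k=0}^{n}\binom{n}{k}B_{k,\chi}(w_{3}y_{1})\sum_{a=0}^{w_{2}d-1}\chi(a)B_{n-k,\chi}\Big(w_{1}y_{2}+\frac{w_{1}}{w_{2}}a\Big)w_{3}^{n-k}w_{1}^{k}\\ =&w_{2}^{n-1}\sum_{k=0}^{n}\binom{n}{k}B_{k,\chi}(w_{1}y_{1})\sum_{a=0}^{w_{2}d-1}\chi(a)B_{n-k,\chi}\Big(w_{3}y_{2}+\frac{w_{3}}{w_{2}}a\Big)w_{1}^{n-k}w_{3}^{k}\\ =&w_{3}^{n-1}\sum_{k=0}^{n}\binom{n}{k}B_{k,\chi}(w_{2}y_{1})\sum_{a=0}^{w_{3}d-1}\chi(a)B_{n-k,\chi}\Big(w_{1}y_{2}+\frac{w_{1}}{w_{3}}a\Big)w_{2}^{n-k}w_{1}^{k}\\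 =&w_{3}^{n-1}\sum_{k=0}^{n}\binom{n}{k}B_{k,\chi}(w_{1}y_{1})\sum_{a=0}^{w_{3}d-1}\chi(a)B_{n-k,\chi}\Big(w_{2}y_{2}+\frac{w_{2}}{w_{3}}a\Big)w_{1}^{n-k}w_{2}^{k}. \end{align*}
   Context: $p$ is a fixed prime, $\mathbb{Z}_p$ the $p$-adic integers; algebraic numbers are viewed in $\mathbb{C}_p$ via a fixed embedding $\overline{\mathbb{Q}}\to\mathbb{C}_p$. The character $\chi$ is regarded as a function on integers (periodic mod $d$, with $\chi(a)=0$ when $\gcd(a,d)>1$; for $d=1$, $\chi\equiv 1$). The generalized Bernoulli polynomials are defined by $\frac{te^{xt}}{e^{dt}-1}\sum_{a=0}^{d-1}\chi(a)e^{at}=\sum_{n\ge0}B_{n,\chi}(x)\frac{t^n}{n!}$. *)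

theory Defs
  imports "HOL-Analysis.Elementary_Topology" "HOL-Computational_Algebra.Polynomial"
    "HOL-Computational_Algebra.Formal_Power_Series"
begin

text \<open>
  The libraries contain no construction of \<open>\<complex>\<^sub>p\<close>. The following locale predicate says that the
  field \<open>'a\<close>, with absolute value \<open>absv\<close>, is a copy of it: a complete, algebraically closed field
  of characteristic 0 whose ultrametric absolute value is normalised by \<open>|p| = 1/p\<close> (hence is the
  \<open>p\<close>-adic one on \<open>\<rat>\<close>), and in which the numbers algebraic over \<open>\<rat>\<close> are dense. These properties
  determine \<open>\<complex>\<^sub>p\<close> up to isometric isomorphism: the closure of \<open>\<rat>\<close> is \<open>\<rat>\<^sub>p\<close>, and density makes \<open>'a\<close>
  the completion of the algebraic closure of \<open>\<rat>\<^sub>p\<close>. Definiteness and nonnegativity of \<open>absv\<close> follow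
  from \<open>dist_absv\<close>.
\<close>

locale padic_complex_numbers =
  fixes p :: nat
    and absv :: "'a :: {alg_closed_field, field_char_0, complete_space} \<Rightarrow> real"
  assumes prime_p: "prime p"
    and dist_absv: "dist x y = absv (x - y)"
    and absv_mult: "absv (x * y) = absv x * absv y"
    and absv_ultra: "absv (x + y) \<le> max (absv x) (absv y)"
    and absv_p: "absv (of_nat p) = 1 / real p"
    and dense_algebraic: "closure {x :: 'a. algebraic x} = UNIV"

text \<open>\<open>\<int>\<^sub>p\<close> as a subset of \<open>\<complex>\<^sub>p\<close>: the \<open>p\<close>-adic closure of \<open>\<int>\<close>.\<close>

definition padic_integers :: "'a :: {field_char_0, metric_space} set" where
  "padic_integers = closure \<int>"

text \<open>
  Embeddings of the field of algebraic numbers (inside \<open>\<complex>\<close>); the values of the function outside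
  that field are irrelevant, and injectivity is automatic.
\<close>

definition algebraic_embedding :: "(complex \<Rightarrow> 'a :: field_char_0) \<Rightarrow> bool" where
  "algebraic_embedding \<iota> \<longleftrightarrow> \<iota> 1 = 1 \<and>
     (\<forall>x y. algebraic x \<longrightarrow> algebraic y \<longrightarrow>
        \<iota> (x + y) = \<iota> x + \<iota> y \<and> \<iota> (x * y) = \<iota> x * \<iota> y)"

definition dirichlet_character :: "nat \<Rightarrow> (int \<Rightarrow> complex) \<Rightarrow> bool" where
  "dirichlet_character d \<chi> \<longleftrightarrow> d > 0 \<and>
     (\<forall>a. \<chi> (a + int d) = \<chi> a) \<and>
     (\<forall>a b. \<chi> (a * b) = \<chi> a * \<chi> b) \<and>
     (\<forall>a. \<chi> a = 0 \<longleftrightarrow> \<not> coprime a (int d))"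

definition conductor :: "nat \<Rightarrow> (int \<Rightarrow> complex) \<Rightarrow> nat" where
  "conductor d \<chi> = (LEAST e. e dvd d \<and>
     (\<exists>\<psi>. dirichlet_character e \<psi> \<and> (\<forall>a. coprime a (int d) \<longrightarrow> \<chi> a = \<psi> a)))"

definition primitive_character :: "nat \<Rightarrow> (int \<Rightarrow> complex) \<Rightarrow> bool" where
  "primitive_character d \<chi> \<longleftrightarrow> dirichlet_character d \<chi> \<and> conductor d \<chi> = d"

text \<open>
  The value \<open>B\<^bsub>n,\<chi>\<^esub>(x)\<close>, read off from the exponential generating function. The denominator
  \<open>e\<^bsup>dt\<^esup> - 1\<close> has subdegree 1, as has \<open>t e\<^bsup>xt\<^esup>\<close>, so the quotient of power series is exact (see
  \<open>gen_bernoulli_generating_function\<close>).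
\<close>

definition gen_bernoulli :: "nat \<Rightarrow> (int \<Rightarrow> 'a) \<Rightarrow> nat \<Rightarrow> 'a :: field_char_0 \<Rightarrow> 'a" where
  "gen_bernoulli d \<chi> n x = fact n * fps_nth
     (fps_X * fps_exp x / (fps_exp (of_nat d) - 1) *
       (\<Sum>a<d. fps_const (\<chi> (int a)) * fps_exp (of_nat a))) n"

lemma gen_bernoulli_generating_function:
  fixes x :: "'a :: field_char_0"
  assumes "d > 0"
  shows "(fps_exp (of_nat d) - 1) * Abs_fps (\<lambda>n. gen_bernoulli d \<chi> n x / fact n) =
    fps_X * fps_exp x * (\<Sum>a<d. fps_const (\<chi> (int a)) * fps_exp (of_nat a))"
proof -
  let ?E = "fps_exp (of_nat d) - 1 :: 'a fps"
  let ?S = "\<Sum>a<d. fps_const (\<chi> (int a)) * fps_exp (of_nat a)"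
  have E1: "fps_nth ?E 1 \<noteq> 0"
    using assms by simp
  hence E: "?E \<noteq> 0"
    by (metis fps_zero_nth)
  have "subdegree ?E \<le> 1"
    using E1 by (rule subdegree_leI)
  moreover have "subdegree (fps_X * fps_exp x :: 'a fps) = 1"
    by (intro subdegreeI) auto
  ultimately have "?E dvd fps_X * fps_exp x"
    using E by (subst fps_dvd_iff) auto
  hence "?E * (fps_X * fps_exp x / ?E) = fps_X * fps_exp x"
    by (rule dvd_mult_div_cancel)
  moreover have "Abs_fps (\<lambda>n. gen_bernoulli d \<chi> n x / fact n) = fps_X * fps_exp x / ?E * ?S"
    by (simp add: fps_eq_iff gen_bernoulli_def)
  ultimately show ?thesis
    by (simp only: mult.assoc [symmetric])
qed

end

theory Submission
  imports Defs
begin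

text \<open>
  Write \<open>S(t) = \<Sum>\<^bsub>a<d\<^esub> \<chi>(a) e\<^bsup>at\<^esup>\<close>. Up to the factor \<open>1/n!\<close>, each of the six expressions is the
  coefficient of \<open>t\<^sup>n\<close> in \<open>1/u\<close> times a product of two generating functions of Bernoulli
  polynomials, taken at \<open>uwt\<close> and \<open>uvt\<close> (which absorbs the power of \<open>u\<close>), and of
  \<open>\<Sum>\<^bsub>a<ud\<^esub> \<chi>(a) e\<^bsup>vwat\<^esup>\<close>. By periodicity this last sum is
  \<open>S(vwt) (e\<^bsup>duvwt\<^esup> - 1) / (e\<^bsup>dvwt\<^esup> - 1)\<close>, so the whole series equals
  \<open>uvw t\<^sup>2 e\<^bsup>uvw(y1+y2)t\<^esup> (e\<^bsup>duvwt\<^esup> - 1) S(uvt) S(uwt) S(vwt) /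
    ((e\<^bsup>duvt\<^esup> - 1) (e\<^bsup>duwt\<^esup> - 1) (e\<^bsup>dvwt\<^esup> - 1))\<close>,
  which is symmetric in \<open>u, v, w\<close>.
\<close>

definition exp_sum :: "nat \<Rightarrow> (int \<Rightarrow> 'a) \<Rightarrow> 'a :: field_char_0 \<Rightarrow> 'a fps" where
  "exp_sum m f c = (\<Sum>a<m. fps_const (f (int a)) * fps_exp (of_nat a * c))"

definition bernoulli_egf :: "nat \<Rightarrow> (int \<Rightarrow> 'a) \<Rightarrow> 'a :: field_char_0 \<Rightarrow> 'a \<Rightarrow> 'a fps" where
  "bernoulli_egf d f c x = Abs_fps (\<lambda>n. c ^ n * (gen_bernoulli d f n x / fact n))"

lemma fps_exp_minus_1_neq_0:
  fixes c :: "'a :: field_char_0"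
  assumes "c \<noteq> 0"
  shows "fps_exp c - 1 \<noteq> 0"
proof
  assume "fps_exp c - 1 = 0"
  hence "fps_nth (fps_exp c - 1) 1 = 0"
    by simp
  with assms show False
    by simp
qed

lemma bernoulli_egf_eq:
  fixes x :: "'a :: field_char_0"
  assumes "d > 0"
  shows "(fps_exp (of_nat d * c) - 1) * bernoulli_egf d f c x =
    fps_const c * fps_X * fps_exp (c * x) * exp_sum d f c"
proof -
  let ?L = "fps_const c * fps_X :: 'a fps"
  have L: "fps_nth ?L 0 = 0"
    by simp
  have egf: "Abs_fps (\<lambda>n. gen_bernoulli d f n x / fact n) oo ?L = bernoulli_egf d f c x"
    by (simp add: fps_compose_linear bernoulli_egf_def)
  have exp: "fps_exp a oo ?L = fps_exp (c * a)" for a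
    by (rule fps_exp_compose_linear)
  have "((fps_exp (of_nat d) - 1) * Abs_fps (\<lambda>n. gen_bernoulli d f n x / fact n)) oo ?L =
    (fps_X * fps_exp x * (\<Sum>a<d. fps_const (f (int a)) * fps_exp (of_nat a))) oo ?L"
    using gen_bernoulli_generating_function [OF assms, of f x] by simp
  thus ?thesis
    unfolding fps_compose_mult_distrib [OF L] fps_compose_sub_distrib fps_compose_sum_distrib
      egf exp fps_X_fps_compose_startby0 [OF L] fps_const_compose fps_compose_1 exp_sum_def
    by (simp only: mult.commute [of c])
qed

lemma exp_sum_mult:
  fixes c :: "'a :: field_char_0"
  assumes periodic: "\<And>a. f (a + int d) = f a"
  shows "(fps_exp (of_nat d * c) - 1) * exp_sum (u * d) f c =
    (fps_exp (of_nat (u * d) * c) - 1) * exp_sum d f c"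
proof (induction u)
  case 0
  show ?case
    by (simp add: exp_sum_def)
next
  case (Suc u)
  have per: "f (int (u * d + a)) = f (int a)" for a
  proof (induction u)
    case (Suc u)
    have "int (Suc u * d + a) = int (u * d + a) + int d"
      by simp
    thus ?case
      using Suc periodic by metis
  qed simp
  have "(\<Sum>a<m + k. g a) = (\<Sum>a<m. g a) + (\<Sum>a<k. g (m + a))" for g :: "nat \<Rightarrow> 'a fps" and m k
    by (induction k) (simp_all add: add.assoc)
  hence "exp_sum (Suc u * d) f c = exp_sum (u * d) f c +
      (\<Sum>a<d. fps_const (f (int (u * d + a))) * fps_exp (of_nat (u * d + a) * c))"
    unfolding exp_sum_def mult_Suc add.commute [of d] by this
  also have "(\<Sum>a<d. fps_const (f (int (u * d + a))) * fps_exp (of_nat (u * d + a) * c)) =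
      fps_exp (of_nat (u * d) * c) * exp_sum d f c"
    unfolding exp_sum_def sum_distrib_left
    by (simp only: per of_nat_add [where 'a = 'a] distrib_right fps_exp_add_mult)
      (simp only: mult_ac)
  finally have "(fps_exp (of_nat d * c) - 1) * exp_sum (Suc u * d) f c =
      (fps_exp (of_nat d * c) - 1) * exp_sum (u * d) f c +
      (fps_exp (of_nat d * c) - 1) * (fps_exp (of_nat (u * d) * c) * exp_sum d f c)"
    by (simp only: distrib_left)
  also have "\<dots> = (fps_exp (of_nat d * c) * fps_exp (of_nat (u * d) * c) - 1) * exp_sum d f c"
    unfolding Suc.IH by (simp add: algebra_simps)
  also have "fps_exp (of_nat d * c) * fps_exp (of_nat (u * d) * c) =
      fps_exp (of_nat (Suc u * d) * c)"
    by (simp add: fps_exp_add_mult [symmetric] algebra_simps)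
  finally show ?case .
qed

lemma three_weight_egf:
  fixes y1 y2 :: "'a :: field_char_0" and u v w :: nat
  assumes d: "d > 0" and periodic: "\<And>a. f (a + int d) = f a"
    and pos: "u > 0" "v > 0" "w > 0"
  defines "U \<equiv> of_nat u :: 'a" and "V \<equiv> of_nat v" and "W \<equiv> of_nat w"
  defines "E \<equiv> \<lambda>c :: 'a. fps_exp (of_nat d * c) - 1"
  shows "fps_const (1 / U) * bernoulli_egf d f (U * W) (V * y1) *
      (\<Sum>a<u * d. fps_const (f (int a)) *
        bernoulli_egf d f (U * V) (W * y2 + W / U * of_nat a)) =
    fps_const (U * V * W) * fps_X ^ 2 * fps_exp (U * V * W * (y1 + y2)) * E (U * V * W) *
      (exp_sum d f (U * V) * exp_sum d f (U * W) * exp_sum d f (V * W)) div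
      (E (U * V) * E (U * W) * E (V * W))"
    (is "?lhs = ?N div ?D")
proof -
  have nz: "U \<noteq> 0" "V \<noteq> 0" "W \<noteq> 0"
    using pos by (simp_all add: U_def V_def W_def)
  have D: "?D \<noteq> 0"
    using d nz by (simp add: E_def fps_exp_minus_1_neq_0)
  let ?s = "\<Sum>a<u * d. fps_const (f (int a)) *
        bernoulli_egf d f (U * V) (W * y2 + W / U * of_nat a)"
  let ?e = "exp_sum (u * d) f (V * W)"
  have "E (U * V) * ?s = (\<Sum>a<u * d. fps_const (f (int a)) *
      (fps_const (U * V) * fps_X * fps_exp (U * V * (W * y2 + W / U * of_nat a)) *
        exp_sum d f (U * V)))"
    unfolding bernoulli_egf_eq [OF d, symmetric] E_def by (simp add: sum_distrib_left mult_ac)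
  also have "\<dots> = fps_const (U * V) * fps_X * fps_exp (U * V * W * y2) * exp_sum d f (U * V) * ?e"
  proof -
    have "fps_exp (U * V * (W * y2 + W / U * of_nat a)) =
        fps_exp (U * V * W * y2) * fps_exp (of_nat a * (V * W))" for a
      using nz by (simp add: fps_exp_add_mult [symmetric] field_simps)
    thus ?thesis
      unfolding exp_sum_def [of "u * d"] by (simp add: sum_distrib_left mult_ac)
  qed
  finally have s: "E (U * V) * ?s =
    fps_const (U * V) * fps_X * fps_exp (U * V * W * y2) * exp_sum d f (U * V) * ?e" .
  have b: "E (U * W) * bernoulli_egf d f (U * W) (V * y1) =
    fps_const (U * W) * fps_X * fps_exp (U * V * W * y1) * exp_sum d f (U * W)"
    using bernoulli_egf_eq [OF d, of "U * W" f "V * y1"] by (simp add: E_def mult_ac)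
  have e: "E (V * W) * ?e = E (U * V * W) * exp_sum d f (V * W)"
    using exp_sum_mult [of f d "V * W" u, OF periodic] by (simp add: E_def U_def mult_ac)
  have c: "fps_const (1 / U) * (fps_const (U * W) * fps_const (U * V)) = fps_const (U * V * W)"
    using nz by (simp add: mult_ac)
  have x: "fps_exp (U * V * W * y1) * fps_exp (U * V * W * y2) = fps_exp (U * V * W * (y1 + y2))"
    by (simp add: fps_exp_add_mult [symmetric] distrib_left)
  have "?D * ?lhs = fps_const (1 / U) * (E (U * W) * bernoulli_egf d f (U * W) (V * y1)) *
      (E (U * V) * ?s) * E (V * W)"
    by (simp only: mult_ac)
  also have "\<dots> = (fps_const (1 / U) * (fps_const (U * W) * fps_const (U * V))) * fps_X ^ 2 *
      (fps_exp (U * V * W * y1) * fps_exp (U * V * W * y2)) *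
      (exp_sum d f (U * V) * exp_sum d f (U * W)) * (E (V * W) * ?e)"
    unfolding s b by (simp only: mult_ac power2_eq_square)
  also have "\<dots> = ?N"
    unfolding c x e by (simp only: mult_ac)
  finally have "?N = ?D * ?lhs"
    by (rule sym)
  thus ?thesis
    by (simp only: nonzero_mult_div_cancel_left [OF D])
qed

lemma three_weight_sum_eq_coeff:
  fixes y1 y2 :: "'a :: field_char_0" and u v w n d :: nat and f :: "int \<Rightarrow> 'a"
  assumes "u > 0"
  defines "U \<equiv> of_nat u :: 'a" and "V \<equiv> of_nat v" and "W \<equiv> of_nat w"
  defines "B \<equiv> gen_bernoulli d f"
  shows "U powi (int n - 1) *
      (\<Sum>k\<le>n. of_nat (n choose k) * B k (V * y1) *
        (\<Sum>a<u * d. f (int a) * B (n - k) (W * y2 + W / U * of_nat a)) * V ^ (n - k) * W ^ k) =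
    fact n * fps_nth (fps_const (1 / U) * bernoulli_egf d f (U * W) (V * y1) *
      (\<Sum>a<u * d. fps_const (f (int a)) *
        bernoulli_egf d f (U * V) (W * y2 + W / U * of_nat a))) n"
proof -
  let ?b = "\<lambda>k a. B k (W * y2 + W / U * of_nat a)"
  have U: "U \<noteq> 0"
    using assms(1) by (simp add: U_def)
  have p: "U powi (int n - 1) = U ^ n * (1 / U)"
    using U by (simp add: power_int_diff)
  have coeff: "U ^ n * (1 / U) * (of_nat (n choose k) * B k (V * y1) *
        (\<Sum>a<u * d. f (int a) * ?b (n - k) a) * V ^ (n - k) * W ^ k) =
      fact n * (1 / U * ((U * W) ^ k * (B k (V * y1) / fact k) *
        (\<Sum>a<u * d. f (int a) * ((U * V) ^ (n - k) * (?b (n - k) a / fact (n - k))))))"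
    if "k \<le> n" for k
  proof -
    have s: "(\<Sum>a<u * d. f (int a) * ((U * V) ^ (n - k) * (?b (n - k) a / fact (n - k)))) =
        (U * V) ^ (n - k) / fact (n - k) * (\<Sum>a<u * d. f (int a) * ?b (n - k) a)"
      by (simp add: sum_distrib_left mult_ac)
    have "U ^ n = U ^ k * U ^ (n - k)"
      using that by (simp flip: power_add)
    thus ?thesis
      unfolding s using that by (simp add: binomial_fact power_mult_distrib)
  qed
  have "U powi (int n - 1) *
      (\<Sum>k\<le>n. of_nat (n choose k) * B k (V * y1) *
        (\<Sum>a<u * d. f (int a) * ?b (n - k) a) * V ^ (n - k) * W ^ k) =
    (\<Sum>k\<le>n. fact n * (1 / U * ((U * W) ^ k * (B k (V * y1) / fact k) *
        (\<Sum>a<u * d. f (int a) * ((U * V) ^ (n - k) * (?b (n - k) a / fact (n - k)))))))"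
    unfolding p sum_distrib_left [of "U ^ n * (1 / U)"] by (intro sum.cong coeff) simp_all
  also have "\<dots> = fact n * (1 / U * (\<Sum>k\<le>n. (U * W) ^ k * (B k (V * y1) / fact k) *
        (\<Sum>a<u * d. f (int a) * ((U * V) ^ (n - k) * (?b (n - k) a / fact (n - k))))))"
    by (simp only: sum_distrib_left)
  also have "\<dots> = fact n * fps_nth (fps_const (1 / U) * (bernoulli_egf d f (U * W) (V * y1) *
      (\<Sum>a<u * d. fps_const (f (int a)) *
        bernoulli_egf d f (U * V) (W * y2 + W / U * of_nat a)))) n"
    unfolding fps_mult_left_const_nth fps_mult_nth [of "bernoulli_egf d f c x" for c x]
      fps_sum_nth by (simp only: bernoulli_egf_def fps_nth_Abs_fps atLeast0AtMost B_def)
  finally show ?thesis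
    by (simp only: mult.assoc [of "fps_const (1 / U)"])
qed

theorem theorem3:
  fixes p d n w1 w2 w3 :: nat
    and absv :: "'a :: {alg_closed_field, field_char_0, complete_space} \<Rightarrow> real"
    and \<iota> :: "complex \<Rightarrow> 'a"
    and \<chi> :: "int \<Rightarrow> complex"
    and y1 y2 :: 'a
  assumes "padic_complex_numbers p absv"
    and "algebraic_embedding \<iota>"
    and "d > 0"
    and "primitive_character d \<chi>"
    and "w1 > 0" "w2 > 0" "w3 > 0"
    and "y1 \<in> padic_integers" "y2 \<in> padic_integers"
  shows "let B = gen_bernoulli d (\<lambda>a. \<iota> (\<chi> a));
             T = (\<lambda>u v w :: nat.
               of_nat u powi (int n - 1) *
               (\<Sum>k\<le>n. of_nat (n choose k) * B k (of_nat v * y1) *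
                 (\<Sum>a<u * d. \<iota> (\<chi> (int a)) *
                    B (n - k) (of_nat w * y2 + of_nat w / of_nat u * of_nat a)) *
                 of_nat v ^ (n - k) * of_nat w ^ k))
         in T w1 w3 w2 = T w1 w2 w3 \<and>
            T w1 w2 w3 = T w2 w3 w1 \<and>
            T w2 w3 w1 = T w2 w1 w3 \<and>
            T w2 w1 w3 = T w3 w2 w1 \<and>
            T w3 w2 w1 = T w3 w1 w2"
proof -
  define f where "f = (\<lambda>a. \<iota> (\<chi> a))"
  have periodic: "f (a + int d) = f a" for a
    using assms(4) by (simp add: f_def primitive_character_def dirichlet_character_def)
  have f: "f a = \<iota> (\<chi> a)" for a
    by (simp add: f_def)
  note sum_eq = three_weight_sum_eq_coeff [where f = f and d = d]
    three_weight_egf [where f = f, OF \<open>d > 0\<close> periodic]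
  show ?thesis
    using assms(5-7) unfolding Let_def f [symmetric]
    by (simp only: sum_eq) (simp only: mult_ac simp_thms)
qed

end
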